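(* Let $a,b\in\mathbb{C}$ with $b\neq-1$, and let $\mathcal{W}(a,b)$ be the complex Lie algebra with basis $\{L_i,I_j\}_{i,j\in\mathbb{Z}}$ and brackets $[L_m,L_n]=(m-n)L_{m+n}$, $[L_m,I_n]=-(n+a+bm)I_{m+n}$, $[I_m,I_n]=0$. Then there are no non-trivial transposed Poisson algebra structures defined on $\mathcal{W}(a,b)$.
   Context: A transposed Poisson algebra structure on a complex Lie algebra $(\mathfrak{L},[\;,\;])$ is a bilinear operation $\cdot$ on $\mathfrak{L}$ such that $(\mathfrak{L},\cdot)$ is commutative and associative (not necessarily unital) and $2z\cdot[x,y]=[z\cdot x,y]+[x,z\cdot y]$ for all $x,y,z\in\mathfrak{L}$. The structure is non-trivial if both operations $\cdot$ and $[\;,\;]$ are not identically zero. *)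

theory Defs
  imports Complex_Main "HOL-Library.Poly_Mapping"
begin

locale complex_lie_algebra = vector_space scale
  for scale :: "complex \<Rightarrow> 'a::ab_group_add \<Rightarrow> 'a" +
  fixes bracket :: "'a \<Rightarrow> 'a \<Rightarrow> 'a"
  assumes bracket_linear_right: "Vector_Spaces.linear scale scale (\<lambda>y. bracket x y)"
    and bracket_linear_left: "Vector_Spaces.linear scale scale (\<lambda>x. bracket x y)"
    and bracket_self: "bracket x x = 0"
    and jacobi: "bracket x (bracket y z) + bracket y (bracket z x) + bracket z (bracket x y) = 0"

locale transposed_poisson_algebra = complex_lie_algebra scale bracket
  for scale :: "complex \<Rightarrow> 'a::ab_group_add \<Rightarrow> 'a"
    and bracket :: "'a \<Rightarrow> 'a \<Rightarrow> 'a" +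
  fixes mult :: "'a \<Rightarrow> 'a \<Rightarrow> 'a"
  assumes mult_linear_right: "Vector_Spaces.linear scale scale (\<lambda>y. mult x y)"
    and mult_linear_left: "Vector_Spaces.linear scale scale (\<lambda>x. mult x y)"
    and mult_commute: "mult x y = mult y x"
    and mult_assoc: "mult (mult x y) z = mult x (mult y z)"
    and transposed_leibniz:
      "scale 2 (mult z (bracket x y)) = bracket (mult z x) y + bracket x (mult z y)"

definition nontrivial_transposed_poisson ::
    "(complex \<Rightarrow> 'a::ab_group_add \<Rightarrow> 'a) \<Rightarrow> ('a \<Rightarrow> 'a \<Rightarrow> 'a) \<Rightarrow> ('a \<Rightarrow> 'a \<Rightarrow> 'a) \<Rightarrow> bool" where
  "nontrivial_transposed_poisson scale bracket mult \<longleftrightarrow>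
     transposed_poisson_algebra scale bracket mult \<and>
     (\<exists>x y. mult x y \<noteq> 0) \<and> (\<exists>x y. bracket x y \<noteq> 0)"

datatype w_index = L_idx int | I_idx int

type_synonym w_space = "w_index \<Rightarrow>\<^sub>0 complex"

definition w_scale :: "complex \<Rightarrow> w_space \<Rightarrow> w_space" where
  "w_scale c x = Poly_Mapping.map (\<lambda>d. c * d) x"

definition w_basis :: "w_index \<Rightarrow> w_space" where
  "w_basis i = Poly_Mapping.single i 1"

(* The third equation is forced by antisymmetry. *)
fun w_basis_bracket :: "complex \<Rightarrow> complex \<Rightarrow> w_index \<Rightarrow> w_index \<Rightarrow> w_space" where
  "w_basis_bracket a b (L_idx m) (L_idx n) = w_scale (of_int (m - n)) (w_basis (L_idx (m + n)))"
| "w_basis_bracket a b (L_idx m) (I_idx n) =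
     w_scale (- (of_int n + a + b * of_int m)) (w_basis (I_idx (m + n)))"
| "w_basis_bracket a b (I_idx n) (L_idx m) =
     w_scale (of_int n + a + b * of_int m) (w_basis (I_idx (m + n)))"
| "w_basis_bracket a b (I_idx m) (I_idx n) = 0"

(* Bilinear extension of the bracket table; the supports are finite. *)
definition w_bracket :: "complex \<Rightarrow> complex \<Rightarrow> w_space \<Rightarrow> w_space \<Rightarrow> w_space" where
  "w_bracket a b x y =
     (\<Sum>i\<in>Poly_Mapping.keys x. \<Sum>j\<in>Poly_Mapping.keys y.
        w_scale (Poly_Mapping.lookup x i * Poly_Mapping.lookup y j) (w_basis_bracket a b i j))"

text \<open>The definitions above indeed give a vector space with the stated basis and bracket
  table, and the bracket is a Lie bracket.\<close>

lemma lookup_w_scale [simp]: "Poly_Mapping.lookup (w_scale c x) i = c * Poly_Mapping.lookup x i"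
  by (simp add: w_scale_def Poly_Mapping.map.rep_eq when_def)

lemma vector_space_w_scale: "vector_space w_scale"
  by unfold_locales (auto intro!: poly_mapping_eqI simp: lookup_add algebra_simps)

interpretation w: vector_space w_scale
  by (rule vector_space_w_scale)

lemma w_expansion:
  assumes "finite A" "Poly_Mapping.keys x \<subseteq> A"
  shows "x = (\<Sum>i\<in>A. w_scale (Poly_Mapping.lookup x i) (w_basis i))"
proof (rule poly_mapping_eqI)
  fix k
  have "(\<Sum>i\<in>A. Poly_Mapping.lookup x i * (1 when i = k)) = Poly_Mapping.lookup x k"
    using assms by (cases "k \<in> A") (auto simp: when_def if_distrib in_keys_iff cong: if_cong)
  then show "Poly_Mapping.lookup x k =
      Poly_Mapping.lookup (\<Sum>i\<in>A. w_scale (Poly_Mapping.lookup x i) (w_basis i)) k"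
    by (simp add: lookup_sum w_basis_def lookup_single)
qed

lemma inj_w_basis: "inj w_basis"
  by (auto simp: inj_def w_basis_def poly_mapping_eq_iff fun_eq_iff lookup_single when_def
      split: if_splits)

lemma span_w_basis: "w.span (range w_basis) = UNIV"
proof -
  have "(\<Sum>i\<in>Poly_Mapping.keys x. w_scale (Poly_Mapping.lookup x i) (w_basis i))
      \<in> w.span (range w_basis)" for x :: w_space
    by (intro w.span_sum w.span_scale w.span_base) simp
  then have "x \<in> w.span (range w_basis)" for x
    using w_expansion[of "Poly_Mapping.keys x" x] by (metis finite_keys order_refl)
  then show ?thesis by auto
qed

lemma independent_w_basis: "w.independent (range w_basis)"
  unfolding w.independent_explicit_module
proof (intro allI impI)
  fix t u v
  assume t: "finite t" "t \<subseteq> range w_basis" "(\<Sum>v\<in>t. w_scale (u v) v) = 0" "v \<in> t"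
  then obtain i where i: "v = w_basis i" by auto
  have "Poly_Mapping.lookup (\<Sum>v\<in>t. w_scale (u v) v) i = (\<Sum>w\<in>t. if w = v then u v else 0)"
    unfolding lookup_sum
  proof (intro sum.cong refl)
    fix w assume "w \<in> t"
    then obtain j where "w = w_basis j" using t by auto
    then show "Poly_Mapping.lookup (w_scale (u w) w) i = (if w = v then u v else 0)"
      using i inj_eq[OF inj_w_basis, of j i]
      by (cases "j = i") (auto simp: w_basis_def lookup_single when_def)
  qed
  then show "u v = 0" using t by simp
qed

lemma w_bracket_superset:
  assumes "finite A" "finite B" "Poly_Mapping.keys x \<subseteq> A" "Poly_Mapping.keys y \<subseteq> B"
  shows "w_bracket a b x y =
     (\<Sum>i\<in>A. \<Sum>j\<in>B.
        w_scale (Poly_Mapping.lookup x i * Poly_Mapping.lookup y j) (w_basis_bracket a b i j))"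
proof -
  have "w_bracket a b x y =
     (\<Sum>i\<in>Poly_Mapping.keys x. \<Sum>j\<in>B.
        w_scale (Poly_Mapping.lookup x i * Poly_Mapping.lookup y j) (w_basis_bracket a b i j))"
    unfolding w_bracket_def using assms
    by (intro sum.cong refl sum.mono_neutral_left) (auto simp: in_keys_iff)
  also have "\<dots> = (\<Sum>i\<in>A. \<Sum>j\<in>B.
        w_scale (Poly_Mapping.lookup x i * Poly_Mapping.lookup y j) (w_basis_bracket a b i j))"
    using assms by (intro sum.mono_neutral_left) (auto simp: in_keys_iff)
  finally show ?thesis .
qed

lemma w_bracket_basis: "w_bracket a b (w_basis i) (w_basis j) = w_basis_bracket a b i j"
  by (simp add: w_bracket_def w_basis_def)

lemma w_bracket_table:
  "w_bracket a b (w_basis (L_idx m)) (w_basis (L_idx n)) =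
     w_scale (of_int (m - n)) (w_basis (L_idx (m + n)))"
  "w_bracket a b (w_basis (L_idx m)) (w_basis (I_idx n)) =
     w_scale (- (of_int n + a + b * of_int m)) (w_basis (I_idx (m + n)))"
  "w_bracket a b (w_basis (I_idx m)) (w_basis (I_idx n)) = 0"
  by (simp_all add: w_bracket_basis)

lemma w_bracket_add_right: "w_bracket a b x (y + z) = w_bracket a b x y + w_bracket a b x z"
proof -
  let ?B = "Poly_Mapping.keys y \<union> Poly_Mapping.keys z"
  have "Poly_Mapping.keys (y + z) \<subseteq> ?B" by (rule keys_add)
  then show ?thesis
    by (subst (1 2 3) w_bracket_superset[of "Poly_Mapping.keys x" ?B])
      (auto simp: lookup_add distrib_left w.scale_left_distrib sum.distrib)
qed

lemma w_bracket_add_left: "w_bracket a b (x + y) z = w_bracket a b x z + w_bracket a b y z"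
proof -
  let ?A = "Poly_Mapping.keys x \<union> Poly_Mapping.keys y"
  have "Poly_Mapping.keys (x + y) \<subseteq> ?A" by (rule keys_add)
  then show ?thesis
    by (subst (1 2 3) w_bracket_superset[of ?A "Poly_Mapping.keys z"])
      (auto simp: lookup_add distrib_right w.scale_left_distrib sum.distrib)
qed

lemma keys_w_scale: "Poly_Mapping.keys (w_scale c x) \<subseteq> Poly_Mapping.keys x"
  by (auto simp: in_keys_iff)

lemma w_bracket_scale_right: "w_bracket a b x (w_scale c y) = w_scale c (w_bracket a b x y)"
  by (subst (1 2) w_bracket_superset[of "Poly_Mapping.keys x" "Poly_Mapping.keys y"])
    (use keys_w_scale in \<open>auto simp: w.scale_sum_right algebra_simps\<close>)

lemma w_bracket_scale_left: "w_bracket a b (w_scale c x) y = w_scale c (w_bracket a b x y)"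
  by (subst (1 2) w_bracket_superset[of "Poly_Mapping.keys x" "Poly_Mapping.keys y"])
    (use keys_w_scale in \<open>auto simp: w.scale_sum_right algebra_simps\<close>)

lemma w_bracket_zero [simp]: "w_bracket a b 0 x = 0" "w_bracket a b x 0 = 0"
  by (simp_all add: w_bracket_def)

lemma w_space_induct [case_names zero basis add scale]:
  assumes "P 0" "\<And>i. P (w_basis i)" "\<And>x y. P x \<Longrightarrow> P y \<Longrightarrow> P (x + y)"
    "\<And>c x. P x \<Longrightarrow> P (w_scale c x)"
  shows "P x"
proof -
  have "x \<in> w.span (range w_basis)" by (simp add: span_w_basis)
  then show ?thesis
    by (induction rule: w.span_induct_alt) (auto intro: assms)
qed

lemma w_bracket_antisym: "w_bracket a b x y = - w_bracket a b y x"
proof (induction x rule: w_space_induct)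
  case (basis i)
  show ?case
  proof (induction y rule: w_space_induct)
    case (basis j)
    show ?case
      by (cases i; cases j; rule poly_mapping_eqI; simp add: w_bracket_basis add.commute;
          simp add: algebra_simps)
  qed (simp_all add: w_bracket_add_left w_bracket_add_right w_bracket_scale_left
      w_bracket_scale_right)
qed (simp_all add: w_bracket_add_left w_bracket_add_right w_bracket_scale_left
      w_bracket_scale_right)

lemma w_bracket_self: "w_bracket a b x x = 0"
proof (rule poly_mapping_eqI)
  fix k
  have "Poly_Mapping.lookup (w_bracket a b x x) k = - Poly_Mapping.lookup (w_bracket a b x x) k"
    by (subst w_bracket_antisym) simp
  then show "Poly_Mapping.lookup (w_bracket a b x x) k = Poly_Mapping.lookup 0 k"
    by simp
qed

lemma w_jacobi:
  "w_bracket a b x (w_bracket a b y z) + w_bracket a b y (w_bracket a b z x)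
   + w_bracket a b z (w_bracket a b x y) = 0" (is "?J x y z = 0")
proof -
  note lin = w_bracket_add_left w_bracket_add_right w_bracket_scale_left w_bracket_scale_right
  have add: "?J (x + x') y z = ?J x y z + ?J x' y z" "?J y (x + x') z = ?J y x z + ?J y x' z"
    "?J y z (x + x') = ?J y z x + ?J y z x'" for x x' y z
    by (simp_all add: lin)
  have scale: "?J (w_scale c x) y z = w_scale c (?J x y z)"
    "?J y (w_scale c x) z = w_scale c (?J y x z)"
    "?J y z (w_scale c x) = w_scale c (?J y z x)" for c x y z
    by (simp_all add: lin w.scale_right_distrib)
  have base: "?J (w_basis i) (w_basis j) (w_basis k) = 0" for i j k
    by (cases i; cases j; cases k; rule poly_mapping_eqI;
        simp add: w_bracket_basis lin lookup_add add.commute add.left_commute;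
        simp add: algebra_simps)
  have 1: "?J (w_basis i) (w_basis j) z = 0" for i j z
    by (induction z rule: w_space_induct) (simp_all only: add scale base, simp_all)
  have 2: "?J (w_basis i) y z = 0" for i y z
    by (induction y rule: w_space_induct) (simp_all only: add scale 1, simp_all)
  show ?thesis
    by (induction x rule: w_space_induct) (simp_all only: add scale 2, simp_all)
qed

lemma complex_lie_algebra_w: "complex_lie_algebra w_scale (w_bracket a b)"
  by unfold_locales
    (simp_all add: w_bracket_add_left w_bracket_add_right w_bracket_scale_left
      w_bracket_scale_right w_bracket_self w_jacobi)

end

theory Submission
  imports Defs
begin

text \<open>
  In a transposed Poisson algebra each multiplication operator \<open>D = mult z\<close> is a half-derivation:
  \<open>2 D[x,y] = [Dx,y] + [x,Dy]\<close>. The point is that for \<open>b \<noteq> -1\<close> the only half-derivations of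
  \<open>W(a,b)\<close> are the scalars (\<open>half_derivation_scalar\<close>). Once this is known,
  \<open>c(z) x = mult z x = mult x z = c(x) z\<close> for all \<open>x\<close>; as \<open>x\<close> can be chosen independent of \<open>z\<close>,
  the scalar \<open>c(z)\<close> vanishes, and so does the product.

  To determine the half-derivations, split \<open>D\<close> into the components that shift the index by a fixed
  integer \<open>k\<close>. The identity respects the shift, so each component satisfies it on its own, and
  it becomes a linear recurrence for each of the four blocks \<open>L \<rightarrow> L\<close>, \<open>L \<rightarrow> I\<close>, \<open>I \<rightarrow> L\<close>,
  \<open>I \<rightarrow> I\<close>. Bracketing with \<open>L\<^sub>0\<close>, which acts diagonally, determines nearly all coefficients
  of a block; the few resonant indices are then removed by bracketing with other \<open>L\<^sub>m\<close>.

  On the span of the \<open>L\<^sub>m\<close>, the Witt algebra, every shift \<open>L\<^sub>m \<mapsto> L\<^sub>m\<^sub>+\<^sub>k\<close> is a half-derivation, so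
  the first block only yields a constant \<open>c\<^sub>k\<close> (\<open>LL_component_constant\<close>). It is the action on the
  \<open>I\<^sub>n\<close> that kills \<open>c\<^sub>k\<close> for \<open>k \<noteq> 0\<close> (\<open>II_component_shift\<close>). Here \<open>b \<noteq> -1\<close> enters: for
  \<open>b = -1\<close> the \<open>I\<^sub>n\<close> form, up to the parameter \<open>a\<close>, a copy of the adjoint module, and the shifts
  extend to them. For the same reason maps \<open>L\<^sub>m \<mapsto> I\<^sub>m\<^sub>+\<^sub>k\<close> exist only for \<open>b = -1\<close>
  (\<open>LI_component_zero\<close>).
\<close>

definition half_derivation :: "complex \<Rightarrow> complex \<Rightarrow> (w_space \<Rightarrow> w_space) \<Rightarrow> bool" where
  "half_derivation a b D \<longleftrightarrow>
     Vector_Spaces.linear w_scale w_scale D \<and>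
     (\<forall>x y. w_scale 2 (D (w_bracket a b x y)) = w_bracket a b (D x) y + w_bracket a b x (D y))"

section \<open>The recurrences for a component of fixed shift\<close>

text \<open>
  At a resonant index all but one coefficient of a block vanish, and the recurrence says that
  an affine function of the index is zero wherever it does not meet that coefficient again.
\<close>

lemma affine_zero_cofinite:
  fixes u v :: complex
  assumes zero: "\<And>m::int. m \<notin> S \<Longrightarrow> u + v * of_int m = 0" and S: "finite S"
  shows "u = 0" "v = 0"
proof -
  obtain m where m: "m \<notin> S" using ex_new_if_finite[OF infinite_UNIV_int S] by blast
  obtain m' where m': "m' \<notin> insert m S"
    using ex_new_if_finite[OF infinite_UNIV_int, of "insert m S"] S by auto
  have "v * of_int (m' - m) = (u + v * of_int m') - (u + v * of_int m)"
    by (simp add: algebra_simps)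
  then show "v = 0" using zero[OF m] zero[of m'] m' by auto
  then show "u = 0" using zero[OF m] by simp
qed

text \<open>
  Taking \<open>n = 0\<close> gives \<open>(m - k) (f m - f 0) = 0\<close>, which leaves only the index \<open>k\<close> open.
\<close>

lemma LL_component_constant:
  fixes f :: "int \<Rightarrow> complex"
  assumes eq: "\<And>m n. 2 * of_int (m - n) * f (m + n)
                  = of_int (m + k - n) * f m + of_int (m - n - k) * f n"
  shows "f m = f 0"
proof -
  have generic: "f m = f 0" if "m \<noteq> k" for m
  proof -
    have "of_int (m - k) * (f m - f 0) = 0"
      using eq[of m 0] by (simp add: algebra_simps)
    with that show ?thesis by (simp del: of_int_diff)
  qed
  show ?thesis
  proof (cases "m = k \<and> k \<noteq> 0")
    case True
    \<comment> \<open>Neither \<open>n\<close> nor \<open>k + n\<close> is the open index, and the coefficient \<open>2 k - n\<close> of \<open>f k\<close>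
      is nonzero.\<close>
    define n where "n = 3 * k"
    have "f (k + n) = f 0" "f n = f 0"
      using True by (auto intro!: generic simp: n_def)
    then have "of_int k * (f 0 - f k) = 0"
      using eq[of k n] by (simp add: n_def algebra_simps)
    with True show ?thesis by auto
  next
    case False
    then show ?thesis using generic[of m] by (cases "m = 0") auto
  qed
qed

text \<open>
  Here \<open>s\<close> stands for \<open>k + a\<close>. The case \<open>n = 0\<close> expresses \<open>(m - s) f m\<close> through \<open>f 0\<close>, so the
  main step is \<open>f 0 = 0\<close>. The recurrence at \<open>(1, -1)\<close>, cleared of the denominators \<open>m - s\<close>,
  does not depend on \<open>s\<close> any more: up to a numerical factor it reads
  \<open>(b - 2) (b + 1) f 0 = 0\<close>. The spurious root
  \<open>b = 2\<close> is excluded at \<open>(2, 1)\<close>. Afterwards only \<open>f s\<close>, for an integer \<open>s\<close>, could survive.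
\<close>

lemma LI_component_zero:
  fixes f :: "int \<Rightarrow> complex"
  assumes eq: "\<And>m n. 2 * of_int (m - n) * f (m + n)
                  = (of_int m + s + b * of_int n) * f m - (of_int n + s + b * of_int m) * f n"
    and b: "b \<noteq> -1"
  shows "f m = 0"
proof -
  have rec: "(of_int m - s) * f m = - (s + b * of_int m) * f 0" for m
    using eq[of m 0] by (simp add: algebra_simps)
  have f0: "f 0 = 0"
  proof (rule ccontr)
    assume f0: "f 0 \<noteq> 0"
    have "(1 - s) * f 1 = - (s + b) * f 0" "(- 1 - s) * f (- 1) = - (s - b) * f 0"
      "4 * f 0 = (1 + s - b) * f 1 - (- 1 + s + b) * f (- 1)"
      using rec[of 1] rec[of "-1"] eq[of 1 "-1"] by (simp_all add: algebra_simps)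
    then have "(b - 2) * (b + 1) * f 0 = 0" by algebra
    then have "b = 2" using f0 b by (simp add: add_eq_0_iff2)
    then have "(1 - s) * f 1 = - (s + 2) * f 0" "(2 - s) * f 2 = - (s + 4) * f 0"
      "(3 - s) * f 3 = - (s + 6) * f 0"
      "2 * f 3 = (s + 4) * f 2 - (s + 5) * f 1"
      using rec[of 1] rec[of 2] rec[of 3] eq[of 2 1] by (simp_all add: algebra_simps)
    then have "36 * f 0 = 0" by algebra
    with f0 show False by simp
  qed
  show ?thesis
  proof (rule ccontr)
    assume nz: "f m \<noteq> 0"
    have s: "s = of_int m" using rec[of m] nz f0 by simp
    have z: "f n = 0" if "n \<noteq> m" for n using rec[of n] that s f0 by simp
    have affine: "2 * of_int m + b * of_int n = 0" if "n \<notin> {0, m}" for n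
    proof -
      have "(2 * of_int m + b * of_int n) * f m = 0"
        using eq[of m n] z[of n] z[of "m + n"] that s by (simp add: algebra_simps)
      with nz show ?thesis by simp
    qed
    have "2 * of_int m = (0::complex)"
      by (rule affine_zero_cofinite(1)[where S = "{0, m}", OF affine]) simp_all
    with nz f0 show False by simp
  qed
qed

text \<open>
  The case \<open>m = 0\<close> gives \<open>(n + 2 a - k) f n = 0\<close>, so \<open>f\<close> has at most one
  nonzero value \<open>f n\<close>; then \<open>(m - n - k) f n = 0\<close> for every \<open>m \<noteq> 0\<close>.
\<close>

lemma IL_component_zero:
  fixes f :: "int \<Rightarrow> complex"
  assumes eq: "\<And>m n. - 2 * (of_int n + a + b * of_int m) * f (m + n) = of_int (m - n - k) * f n"
  shows "f n = 0"
proof (rule ccontr)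
  assume nz: "f n \<noteq> 0"
  have rec: "of_int j + 2 * a - of_int k = 0" if "f j \<noteq> 0" for j
  proof -
    have "(of_int j + 2 * a - of_int k) * f j = 0"
      using eq[of j 0] by (simp add: algebra_simps)
    with that show ?thesis by simp
  qed
  have z: "f (m + n) = 0" if "m \<noteq> 0" for m
    using rec[OF nz] rec[of "m + n"] that by (auto simp: algebra_simps)
  have affine: "of_int (- n - k) + 1 * of_int m = (0::complex)" if "m \<notin> {0}" for m
  proof -
    have "of_int (m - n - k) * f n = 0" using eq[of n m] z[of m] that by simp
    with nz have "of_int (m - n - k) = (0::complex)" by (simp del: of_int_diff)
    then show ?thesis by (simp add: algebra_simps)
  qed
  have "1 = (0::complex)"
    by (rule affine_zero_cofinite(2)[where S = "{0}", OF affine]) simp_all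
  then show False by simp
qed

text \<open>
  The sequence \<open>g\<close> is the \<open>I \<rightarrow> I\<close> block of shift \<open>k\<close> and \<open>c\<close> the constant value of the \<open>L \<rightarrow> L\<close>
  block. The case \<open>m = 0\<close> gives \<open>(t - k) g n = (t + b k) c\<close> with \<open>t = n + a\<close>. Multiplying the
  recurrence by \<open>(t - k) (t + m - k)\<close> eliminates \<open>g\<close>, also where a factor is zero, and the
  resulting polynomial factors as \<open>c (1 + b) k m ((b - 2) t - b k - b m)\<close>. The last factor
  cannot vanish for all \<open>n\<close> and all \<open>m \<noteq> 0\<close>.
\<close>

lemma II_component_shift:
  fixes g :: "int \<Rightarrow> complex"
  assumes eq: "\<And>m n. 2 * (of_int n + a + b * of_int m) * g (m + n)
        = (of_int n + a + b * of_int (m + k)) * c + (of_int n + of_int k + a + b * of_int m) * g n"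
    and b: "b \<noteq> -1" and k: "k \<noteq> 0"
  shows "c = 0"
proof (rule ccontr)
  assume c: "c \<noteq> 0"
  have rec: "(of_int n + a - of_int k) * g n = (of_int n + a + b * of_int k) * c" for n
    using eq[of n 0] by (simp add: algebra_simps)
  have key: "(b - 2) * (of_int n + a) - b * of_int k - b * of_int m = 0" if m: "m \<noteq> 0" for m n
  proof -
    define t where "t = of_int n + a"
    define M :: complex where "M = of_int m"
    define K :: complex where "K = of_int k"
    have r1: "(t - K) * g n = (t + b * K) * c"
      and r2: "(t + M - K) * g (m + n) = (t + M + b * K) * c"
      using rec[of n] rec[of "m + n"] by (simp_all add: t_def M_def K_def algebra_simps)
    have e: "2 * (t + b * M) * g (m + n) = (t + b * (M + K)) * c + (t + K + b * M) * g n"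
      using eq[of n m] by (simp add: t_def M_def K_def algebra_simps)
    have "2 * (t + b * M) * (t - K) * ((t + M + b * K) * c)
        = (t + b * (M + K)) * c * (t - K) * (t + M - K)
          + (t + K + b * M) * (t + M - K) * ((t + b * K) * c)"
      unfolding r1[symmetric] r2[symmetric] using arg_cong[OF e, of "\<lambda>x. x * ((t - K) * (t + M - K))"]
      by (simp add: algebra_simps)
    then have "c * (1 + b) * K * M * ((b - 2) * t - b * K - b * M) = 0"
      by algebra
    moreover have "1 + b \<noteq> 0" using b by (auto simp: add_eq_0_iff)
    ultimately show ?thesis using c k m by (simp add: t_def M_def K_def)
  qed
  have "b = 0" using key[of 1 0] key[of 2 0] by (simp add: algebra_simps)
  then show False using key[of 1 0] key[of 1 1] by (simp add: algebra_simps)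
qed

text \<open>
  The homogeneous case \<open>c = 0\<close> of the previous recurrence. It is applied to \<open>g\<close> for
  \<open>k \<noteq> 0\<close>, and for \<open>k = 0\<close> to \<open>g\<close> minus the scalar by which \<open>D\<close> acts on the \<open>L\<^sub>m\<close>.
  The case \<open>m = 0\<close> confines the support to \<open>n = k - a\<close>; stepping out of this index forces
  \<open>k = b = 0\<close>, and stepping into it from \<open>n - 1\<close> then gives a contradiction.
\<close>

lemma II_component_homogeneous_zero:
  fixes g :: "int \<Rightarrow> complex"
  assumes eq: "\<And>m n. 2 * (of_int n + a + b * of_int m) * g (m + n)
                  = (of_int n + of_int k + a + b * of_int m) * g n"
  shows "g n = 0"
proof (rule ccontr)
  assume nz: "g n \<noteq> 0"
  have rec: "of_int j + a - of_int k = 0" if "g j \<noteq> 0" for j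
  proof -
    have "(of_int j + a - of_int k) * g j = 0"
      using eq[of j 0] by (simp add: algebra_simps)
    with that show ?thesis by simp
  qed
  have a: "a = of_int k - of_int n" using rec[OF nz] by (simp add: algebra_simps)
  have z: "g j = 0" if "j \<noteq> n" for j
    using rec[of j] that a by (auto simp: algebra_simps)
  have affine: "2 * of_int k + b * of_int m = 0" if "m \<notin> {0}" for m
  proof -
    have "(2 * of_int k + b * of_int m) * g n = 0"
      using eq[of n m] z[of "m + n"] that a by (simp add: algebra_simps)
    with nz show ?thesis by simp
  qed
  have "2 * of_int k = (0::complex)" "b = 0"
    by (rule affine_zero_cofinite[where S = "{0}", OF affine]; simp)+
  then show False using eq[of "n - 1" 1] z[of "n - 1"] nz a by simp
qed

section \<open>Half-derivations\<close>

lemma lookup_w_basis [simp]: "Poly_Mapping.lookup (w_basis i) j = (if i = j then 1 else 0)"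
  by (simp add: w_basis_def lookup_single when_def)

lemma lookup_bracket_L_right:
  "Poly_Mapping.lookup (w_bracket a b x (w_basis (L_idx n))) (L_idx q)
     = of_int (q - 2 * n) * Poly_Mapping.lookup x (L_idx (q - n))"
  "Poly_Mapping.lookup (w_bracket a b x (w_basis (L_idx n))) (I_idx q)
     = (of_int (q - n) + a + b * of_int n) * Poly_Mapping.lookup x (I_idx (q - n))"
proof (induction x rule: w_space_induct)
  case (basis i)
  { case 1 show ?case by (cases i) (auto simp: w_bracket_basis) }
  { case 2 show ?case by (cases i) (auto simp: w_bracket_basis) }
qed (simp_all add: w_bracket_add_left w_bracket_scale_left lookup_add distrib_left)

lemma lookup_bracket_I_right:
  "Poly_Mapping.lookup (w_bracket a b x (w_basis (I_idx n))) (L_idx q) = 0"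
  "Poly_Mapping.lookup (w_bracket a b x (w_basis (I_idx n))) (I_idx q)
     = - (of_int n + a + b * of_int (q - n)) * Poly_Mapping.lookup x (L_idx (q - n))"
proof (induction x rule: w_space_induct)
  case (basis i)
  { case 1 show ?case by (cases i) (auto simp: w_bracket_basis) }
  { case 2 show ?case by (cases i) (auto simp: w_bracket_basis) }
qed (simp_all add: w_bracket_add_left w_bracket_scale_left lookup_add distrib_left)

text \<open>
  A sum over shifts need not be formed: the coefficient of each basis vector in the
  half-derivation identity involves one shift only, so fixing \<open>k\<close> in the families \<open>A\<close>,
  \<open>B\<close>, \<open>E\<close>, \<open>G\<close> of coefficients (blocks \<open>L \<rightarrow> L\<close>, \<open>L \<rightarrow> I\<close>, \<open>I \<rightarrow> L\<close>, \<open>I \<rightarrow> I\<close>)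
  puts the recurrences of the previous section at hand.
\<close>

lemma half_derivation_scalar:
  assumes D: "half_derivation a b D" and b: "b \<noteq> -1"
  obtains c where "\<And>x. D x = w_scale c x"
proof -
  interpret D: Vector_Spaces.linear w_scale w_scale D
    using D by (simp add: half_derivation_def)
  define A B E G where
    "A k m = Poly_Mapping.lookup (D (w_basis (L_idx m))) (L_idx (m + k))" and
    "B k m = Poly_Mapping.lookup (D (w_basis (L_idx m))) (I_idx (m + k))" and
    "E k n = Poly_Mapping.lookup (D (w_basis (I_idx n))) (L_idx (n + k))" and
    "G k n = Poly_Mapping.lookup (D (w_basis (I_idx n))) (I_idx (n + k))" for k m n
  \<comment> \<open>Antisymmetry moves \<open>D\<close> to the left argument, so that coefficients are needed only
    for brackets with a basis vector on the right.\<close>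
  have half: "2 * Poly_Mapping.lookup (D (w_basis_bracket a b i j)) q =
      Poly_Mapping.lookup (w_bracket a b (D (w_basis i)) (w_basis j)) q
      - Poly_Mapping.lookup (w_bracket a b (D (w_basis j)) (w_basis i)) q" for i j q
  proof -
    have "w_scale 2 (D (w_basis_bracket a b i j)) =
        w_bracket a b (D (w_basis i)) (w_basis j) - w_bracket a b (D (w_basis j)) (w_basis i)"
      using D w_bracket_antisym[of a b "w_basis i" "D (w_basis j)"]
      by (simp add: half_derivation_def flip: w_bracket_basis)
    from arg_cong[OF this, of "\<lambda>x. Poly_Mapping.lookup x q"] show ?thesis
      by (simp add: lookup_minus)
  qed
  have A_eq: "2 * of_int (m - n) * A k (m + n)
      = of_int (m + k - n) * A k m + of_int (m - n - k) * A k n" for k m n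
    using half[of "L_idx m" "L_idx n" "L_idx (m + n + k)"]
    by (simp add: A_def D.scale lookup_bracket_L_right; simp add: algebra_simps)
  have B_eq: "2 * of_int (m - n) * B k (m + n)
      = (of_int m + (of_int k + a) + b * of_int n) * B k m
        - (of_int n + (of_int k + a) + b * of_int m) * B k n" for k m n
    using half[of "L_idx m" "L_idx n" "I_idx (m + n + k)"]
    by (simp add: B_def D.scale lookup_bracket_L_right; simp add: algebra_simps)
  have E_eq: "- 2 * (of_int n + a + b * of_int m) * E k (m + n)
      = of_int (m - n - k) * E k n" for k m n
    using half[of "L_idx m" "I_idx n" "L_idx (m + n + k)"]
    by (simp add: E_def D.scale lookup_bracket_L_right lookup_bracket_I_right;
        simp add: algebra_simps)
  have G_eq: "2 * (of_int n + a + b * of_int m) * G k (m + n)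
      = (of_int n + a + b * of_int (m + k)) * A k m
        + (of_int n + of_int k + a + b * of_int m) * G k n" for k m n
    using half[of "L_idx m" "I_idx n" "I_idx (m + n + k)"]
    by (simp add: A_def G_def D.scale lookup_bracket_L_right lookup_bracket_I_right;
        simp add: algebra_simps)
  have A_const: "A k m = A k 0" for k m
    by (rule LL_component_constant[OF A_eq])
  have B0: "B k m = 0" for k m
    by (rule LI_component_zero[OF B_eq b])
  have E0: "E k m = 0" for k m
    by (rule IL_component_zero[OF E_eq])
  have G_eq': "2 * (of_int n + a + b * of_int m) * G k (m + n)
      = (of_int n + a + b * of_int (m + k)) * A k 0
        + (of_int n + of_int k + a + b * of_int m) * G k n" for k m n
    using G_eq[of n m k] A_const[of k m] by simp
  have A_shift: "A k 0 = 0" if "k \<noteq> 0" for k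
    by (rule II_component_shift[OF G_eq' b that])
  define c where "c = A 0 0"
  have G0: "G k n - (if k = 0 then c else 0) = 0" for k n
  proof (rule II_component_homogeneous_zero[where g = "\<lambda>n. G k n - (if k = 0 then c else 0)"
          and a = a and b = b and k = k])
    fix m n
    show "2 * (of_int n + a + b * of_int m) * (G k (m + n) - (if k = 0 then c else 0))
        = (of_int n + of_int k + a + b * of_int m) * (G k n - (if k = 0 then c else 0))"
      using G_eq'[of n m k] A_shift[of k] by (auto simp: c_def algebra_simps)
  qed
  have basis: "D (w_basis i) = w_scale c (w_basis i)" for i
  proof (cases i)
    case (L_idx m)
    show ?thesis
    proof (rule poly_mapping_eqI)
      fix j
      show "Poly_Mapping.lookup (D (w_basis i)) j = Poly_Mapping.lookup (w_scale c (w_basis i)) j"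
      proof (cases j)
        case (L_idx q)
        then show ?thesis
          using A_const[of "q - m" m] A_shift[of "q - m"] \<open>i = L_idx m\<close> by (auto simp: A_def c_def)
      next
        case (I_idx q)
        then show ?thesis using B0[of "q - m" m] \<open>i = L_idx m\<close> by (simp add: B_def)
      qed
    qed
  next
    case (I_idx n)
    show ?thesis
    proof (rule poly_mapping_eqI)
      fix j
      show "Poly_Mapping.lookup (D (w_basis i)) j = Poly_Mapping.lookup (w_scale c (w_basis i)) j"
      proof (cases j)
        case (L_idx q)
        then show ?thesis using E0[of "q - n" n] \<open>i = I_idx n\<close> by (simp add: E_def)
      next
        case (I_idx q)
        then show ?thesis
          using G0[of "q - n" n] \<open>i = I_idx n\<close> by (auto simp: G_def)
      qed
    qed
  qed
  have "D x = w_scale c x" for x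
    by (induction x rule: w_space_induct)
      (simp_all add: basis D.add D.scale w.scale_right_distrib mult.commute)
  then show thesis by (rule that)
qed

theorem corollary22:
  fixes a b :: complex
  assumes "b \<noteq> -1"
  shows "\<not> (\<exists>mult. nontrivial_transposed_poisson w_scale (w_bracket a b) mult)"
proof
  assume "\<exists>mult. nontrivial_transposed_poisson w_scale (w_bracket a b) mult"
  then obtain mult where
    tp: "transposed_poisson_algebra w_scale (w_bracket a b) mult" and
    nz: "\<exists>x y. mult x y \<noteq> 0"
    by (auto simp: nontrivial_transposed_poisson_def)
  interpret tp: transposed_poisson_algebra w_scale "w_bracket a b" mult by (rule tp)
  have "\<exists>c. \<forall>x. mult z x = w_scale c x" for z
    using half_derivation_scalar[of a b "mult z"] assms tp.mult_linear_right tp.transposed_leibniz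
    unfolding half_derivation_def by metis
  then obtain c where c: "\<And>z x. mult z x = w_scale (c z) x" by metis
  have "c z = 0" for z
  proof (rule ccontr)
    assume cz: "c z \<noteq> 0"
    define d where "d i = c (w_basis i)" for i
    have "w_scale (c z) (w_basis i) = w_scale (d i) z" for i
      using tp.mult_commute[of z "w_basis i"] by (simp add: c d_def)
    then have eq: "c z * Poly_Mapping.lookup (w_basis i) j = d i * Poly_Mapping.lookup z j" for i j
      by (metis lookup_w_scale)
    \<comment> \<open>Any two distinct basis vectors would do: \<open>z\<close> would be a multiple of each of them.\<close>
    show False
      using eq[of "L_idx 0" "L_idx 0"] eq[of "L_idx 0" "L_idx 1"] eq[of "L_idx 1" "L_idx 1"] cz
      by auto
  qed
  with c nz show False by simp
qed

end
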